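(* Let $\tau,\mu_1,\mu_2>0$. Let $P$ and $\Sigma$ be continuous-time control systems with states in $\mathbb{R}^{n_1}$ and $\mathbb{R}^{n_2}$ respectively, and with inputs and outputs in $\mathbb{R}^m$. Suppose that $P$ (resp. $\Sigma$) satisfies Assumptions (A1) and (A2) of the context with constant $\gamma_1$ and function $\beta_1$ (resp. constant $\gamma_2$ and function $\beta_2$). Suppose also that $P$ (resp. $\Sigma$) is IF-OFP$(\nu_1,\rho_1)$ (resp. IF-OFP$(\nu_2,\rho_2)$) with a continuous, positive definite, radially unbounded storage function $V_1$ (resp. $V_2$). Let $\lambda_{11},\lambda_{21},\dots,\lambda_{25}>0$ and define $$\nu_1'=\nu_1-\tau\gamma_1-\tau^2\gamma_1^2(1+\lambda_{11})|\rho_1|,\quad \rho_1'=\rho_1-\tfrac{|\rho_1|}{\lambda_{11}},\quad \delta_1(x_1)=\left(|\rho_1|\tau(1+\lambda_{11})+\tfrac1{\gamma_1}\right)\beta_1(x_1),$$ $$\nu_2'=\nu_2-\tau\gamma_2-\tau^2\gamma_2^2(1+\lambda_{21})|\rho_2|,\quad \rho_2'=\rho_2-\tfrac{|\rho_2|}{\lambda_{21}},\quad \delta_2(x_2)=\left(|\rho_2|\tau(1+\lambda_{21})+\tfrac1{\gamma_2}\right)\beta_2(x_2),$$ $$\tilde\nu_2=\nu_2'-\tfrac{|\nu_2'|}{\lambda_{23}}-\tfrac1{4\lambda_{24}},\quad \tilde\rho_2=\rho_2'-\tfrac{|\rho_2'|}{\lambda_{22}}-\tfrac1{4\lambda_{25}},$$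 $$\tilde\delta_2=\left[|\rho_2'|(1+\lambda_{22})+\lambda_{24}\right]m\mu_2^2+\left[|\nu_2'|(1+\lambda_{23})+\lambda_{25}\right]m\mu_1^2 .$$ Then the feedback system $T_\tau(P)\times_{\mathcal F}\tilde T_\tau(\Sigma)$ satisfies, for any $k_0,k_1\in\mathbb{Z}_{\ge0}$ with $k_0<k_1$ and any admissible input $r[k]\in\mathbb{R}^{2m}$, $$V(x[k_1])-V(x[k_0])\le\delta(x[k_0])+\sum_{k=k_0}^{k_1-1}\left(r[k]^\top y[k]-\hat\nu|r[k]|^2-\hat\rho|y[k]|^2+\tilde\delta_2\right),$$ where $x=(x_1^\top,x_2^\top)^\top$, $r=(r_1^\top,r_2^\top)^\top$, $y=(y_1^\top,\tilde y_2^\top)^\top$, $V(x)=\frac1\tau V_1(x_1)+\frac1\tau V_2(x_2)$, $\delta(x[k_0])=\delta_1(x_1[k_0])+\delta_2(x_2[k_0])$, and $\hat\nu,\hat\rho$ are any numbers with $$\hat\nu<\min\{\nu_1',\tilde\nu_2\},\qquad \hat\rho\le\min\left\{\rho_1'-\frac{\hat\nu\tilde\nu_2}{\tilde\nu_2-\hat\nu},\ \tilde\rho_2-\frac{\hat\nu\nu_1'}{\nu_1'-\hat\nu}\right\}.$$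
   Context: $|\cdot|$ is the Euclidean norm. A continuous-time control system is $\dot x=f(x,u)$, $y=h(x,u)$ with state in $\mathbb{R}^n$, input set $U\subseteq\mathbb{R}^m$, outputs in $\mathbb{R}^m$, $f$ Lipschitz, $h$ continuous, $f(0,0)=0$, $h(0,0)=0$, and unique trajectories for every admissible input and initial state. (A1): $h(x,u)=h_1(x)+h_2(u)$. (A2) with constant $\gamma>0$ and function $\beta:\mathbb{R}^n\to\mathbb{R}_{\ge0}$, $\beta(\mathbf 0)=0$: for any initial state $x_0$, any $T>0$ and any admissible $u$, $\int_0^T|\dot h_1(x(t))|^2dt\le\gamma^2\int_0^T|u(t)|^2dt+\beta(x_0)$. IF-OFP$(\nu,\rho)$ with storage function $V$: $V(x(t_1))-V(x(t_0))\le\int_{t_0}^{t_1}(u^\top y-\nu|u|^2-\rho|y|^2)\,ds$ for all $0\le t_0<t_1$, all $x(t_0)$ and all admissible inputs. $T_\tau(\cdot)$: discrete-time system obtained by zero-order hold and uniform sampling with period $\tau$, i.e. $x[k+1]$ is the state reached at time $\tau$ from $x[k]$ under the constant input $u[k]$, and $y[k]=h(x[k],u[k])$. Uniform quantizer with precision $\mu$: $\mathcal Q(s)=\lfloor s/\mu\rfloor\mu$ for $s\ge0$, $\lceil s/\mu\rceil\mu$ for $s<0$, entrywise. $\tilde T_\tau(\Sigma)$ has input $\tilde u_2[k]$ and output $\tilde y_2[k]=\mathcal Q_2(y_2[k])$, where $T_\tau(\Sigma)$, with state $x_2[k]$ and output $y_2[k]$, is driven by $u_2[k]=\mathcal Q_1(\tilde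 u_2[k])$; $\mathcal Q_1,\mathcal Q_2$ have precisions $\mu_1,\mu_2$. $T_\tau(P)\times_{\mathcal F}\tilde T_\tau(\Sigma)$ is the negative feedback connection with external discrete-time inputs $r_1,r_2$: $T_\tau(P)$ has state $x_1[k]$, input $u_1[k]=r_1[k]-\tilde y_2[k]$ and output $y_1[k]$, and $\tilde T_\tau(\Sigma)$ has input $\tilde u_2[k]=r_2[k]+y_1[k]$; all signals are synchronized. *)

theory Defs
  imports "HOL-Analysis.Analysis"
begin

text \<open>
  Continuous-time systems \<open>\<dot>x = f(x,u)\<close>, \<open>y = h(x,u)\<close> with state in \<open>\<real>\<^sup>n\<close>, input set
  \<open>U \<subseteq> \<real>\<^sup>m\<close> and output in \<open>\<real>\<^sup>m\<close>. The maps \<open>dyn\<close> and \<open>out\<close> matter only for inputs in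
  \<open>input_set\<close>, and signals \<open>real \<Rightarrow> _\<close> only on \<open>[0,\<infinity>)\<close>.
\<close>

record ('n::finite, 'm::finite) ctrl_sys =
  input_set :: "(real ^ 'm) set"
  dyn :: "real ^ 'n \<Rightarrow> real ^ 'm \<Rightarrow> real ^ 'n"
  out :: "real ^ 'n \<Rightarrow> real ^ 'm \<Rightarrow> real ^ 'm"

text \<open>
  Admissible inputs are the piecewise continuous \<open>U\<close>-valued functions on \<open>[0,\<infinity>)\<close>. The one-sided
  limits are required to lie in \<open>U\<close> too, so that \<open>h(x,u)\<close> is piecewise continuous along
  trajectories even when \<open>U\<close> is not closed.
\<close>

definition admissible_inputs :: "('n::finite, 'm::finite) ctrl_sys \<Rightarrow> (real \<Rightarrow> real ^ 'm) set" where
  "admissible_inputs S =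
     {u. (\<forall>t\<ge>0. u t \<in> input_set S)
       \<and> (\<forall>T>0. finite {t \<in> {0..T}. \<not> continuous (at t within {0..}) u})
       \<and> (\<forall>t\<ge>0. \<exists>l \<in> input_set S. (u \<longlongrightarrow> l) (at_right t))
       \<and> (\<forall>t>0. \<exists>l \<in> input_set S. (u \<longlongrightarrow> l) (at_left t))}"

text \<open>
  The differential equation may fail at finitely many times in each \<open>[0,T]\<close>, since \<open>u\<close> may jump.
\<close>

definition trajectory ::
  "('n::finite, 'm::finite) ctrl_sys \<Rightarrow> (real \<Rightarrow> real ^ 'm) \<Rightarrow> (real \<Rightarrow> real ^ 'n) \<Rightarrow> bool" where
  "trajectory S u x \<longleftrightarrow>
     continuous_on {0..} x
   \<and> (\<forall>T>0. \<exists>N. finite N \<and>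
        (\<forall>t \<in> {0..T} - N. (x has_vector_derivative dyn S (x t) (u t)) (at t within {0..T})))"

definition control_system :: "('n::finite, 'm::finite) ctrl_sys \<Rightarrow> bool" where
  "control_system S \<longleftrightarrow>
     0 \<in> input_set S
   \<and> (\<exists>L. L-lipschitz_on (UNIV \<times> input_set S) (\<lambda>(x, u). dyn S x u))
   \<and> continuous_on (UNIV \<times> input_set S) (\<lambda>(x, u). out S x u)
   \<and> dyn S 0 0 = 0 \<and> out S 0 0 = 0
   \<and> (\<forall>u \<in> admissible_inputs S. \<forall>x0.
        (\<exists>x. trajectory S u x \<and> x 0 = x0)
      \<and> (\<forall>x x'. trajectory S u x \<and> trajectory S u x' \<and> x 0 = x0 \<and> x' 0 = x0
            \<longrightarrow> (\<forall>t\<ge>0. x t = x' t)))"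

definition output_splits ::
  "('n::finite, 'm::finite) ctrl_sys \<Rightarrow> (real ^ 'n \<Rightarrow> real ^ 'm) \<Rightarrow> (real ^ 'm \<Rightarrow> real ^ 'm) \<Rightarrow> bool" where
  "output_splits S h1 h2 \<longleftrightarrow> (\<forall>x. \<forall>u \<in> input_set S. out S x u = h1 x + h2 u)"

text \<open>
  The bound on \<open>\<integral>\<^sub>0\<^sup>T |\<dot>h\<^sub>1(x(t))|\<^sup>2 dt\<close> presupposes that the derivative exists and that the integral
  is finite; as \<open>integral\<close> is 0 on non-integrable functions, both are stated explicitly.
  The derivative of \<open>t \<mapsto> h\<^sub>1(x(t))\<close> may be missing at finitely many times, as that of \<open>x\<close> itself.
\<close>

definition output_rate_bounded ::
  "('n::finite, 'm::finite) ctrl_sys \<Rightarrow> (real ^ 'n \<Rightarrow> real ^ 'm) \<Rightarrow> real \<Rightarrow> (real ^ 'n \<Rightarrow> real) \<Rightarrow> bool" where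
  "output_rate_bounded S h1 \<gamma> \<beta> \<longleftrightarrow>
     \<gamma> > 0 \<and> (\<forall>x. \<beta> x \<ge> 0) \<and> \<beta> 0 = 0
   \<and> (\<forall>u \<in> admissible_inputs S. \<forall>x. trajectory S u x \<longrightarrow> (\<forall>T>0.
        let dh = (\<lambda>t. vector_derivative (h1 \<circ> x) (at t within {0..T})) in
          (h1 \<circ> x) piecewise_differentiable_on {0..T}
        \<and> (\<lambda>t. (norm (dh t))\<^sup>2) integrable_on {0..T}
        \<and> integral {0..T} (\<lambda>t. (norm (dh t))\<^sup>2)
            \<le> \<gamma>\<^sup>2 * integral {0..T} (\<lambda>t. (norm (u t))\<^sup>2) + \<beta> (x 0)))"

definition storage_function :: "(real ^ 'n::finite \<Rightarrow> real) \<Rightarrow> bool" where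
  "storage_function V \<longleftrightarrow>
     continuous_on UNIV V \<and> V 0 = 0 \<and> (\<forall>x. x \<noteq> 0 \<longrightarrow> V x > 0) \<and> filterlim V at_top at_infinity"

definition IF_OFP ::
  "('n::finite, 'm::finite) ctrl_sys \<Rightarrow> (real ^ 'n \<Rightarrow> real) \<Rightarrow> real \<Rightarrow> real \<Rightarrow> bool" where
  "IF_OFP S V \<nu> \<rho> \<longleftrightarrow>
     (\<forall>u \<in> admissible_inputs S. \<forall>x. trajectory S u x \<longrightarrow> (\<forall>t0 t1. 0 \<le> t0 \<and> t0 < t1 \<longrightarrow>
        V (x t1) - V (x t0)
          \<le> integral {t0..t1} (\<lambda>s. u s \<bullet> out S (x s) (u s)
               - \<nu> * (norm (u s))\<^sup>2 - \<rho> * (norm (out S (x s) (u s)))\<^sup>2)))"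

text \<open>
  Discrete-time systems are given by their behaviours: \<open>sampled \<tau> S u x y\<close> says that \<open>u\<close>, \<open>x\<close>, \<open>y\<close>
  are input, state and output sequences of the zero-order-hold discretization of \<open>S\<close>.
\<close>

definition sampled ::
  "real \<Rightarrow> ('n::finite, 'm::finite) ctrl_sys
     \<Rightarrow> (nat \<Rightarrow> real ^ 'm) \<Rightarrow> (nat \<Rightarrow> real ^ 'n) \<Rightarrow> (nat \<Rightarrow> real ^ 'm) \<Rightarrow> bool" where
  "sampled \<tau> S u x y \<longleftrightarrow>
     (\<forall>k. u k \<in> input_set S
        \<and> (\<exists>\<xi>. trajectory S (\<lambda>_. u k) \<xi> \<and> \<xi> 0 = x k \<and> \<xi> \<tau> = x (Suc k))
        \<and> y k = out S (x k) (u k))"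

definition quantize1 :: "real \<Rightarrow> real \<Rightarrow> real" where
  "quantize1 \<mu> s =
     (if s \<ge> 0 then of_int \<lfloor>s / \<mu>\<rfloor> * \<mu> else of_int \<lceil>s / \<mu>\<rceil> * \<mu>)"

definition quantize :: "real \<Rightarrow> real ^ 'm \<Rightarrow> real ^ 'm::finite" where
  "quantize \<mu> v = (\<chi> i. quantize1 \<mu> (v $ i))"

definition quantized_sampled ::
  "real \<Rightarrow> real \<Rightarrow> real \<Rightarrow> ('n::finite, 'm::finite) ctrl_sys
     \<Rightarrow> (nat \<Rightarrow> real ^ 'm) \<Rightarrow> (nat \<Rightarrow> real ^ 'n) \<Rightarrow> (nat \<Rightarrow> real ^ 'm) \<Rightarrow> bool" where
  "quantized_sampled \<tau> \<mu>1 \<mu>2 S v x z \<longleftrightarrow>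
     (\<exists>y. sampled \<tau> S (\<lambda>k. quantize \<mu>1 (v k)) x y \<and> (\<forall>k. z k = quantize \<mu>2 (y k)))"

text \<open>
  Pairs stand for stacked vectors; the product type carries the Euclidean norm and inner product.
  An external input \<open>r\<close> is admissible if the loop has signals \<open>x\<close>, \<open>y\<close> for it, in particular with
  both plant inputs in the respective input sets.
\<close>

definition feedback ::
  "real \<Rightarrow> real \<Rightarrow> real \<Rightarrow> ('n1::finite, 'm::finite) ctrl_sys \<Rightarrow> ('n2::finite, 'm) ctrl_sys
     \<Rightarrow> (nat \<Rightarrow> (real ^ 'm) \<times> (real ^ 'm)) \<Rightarrow> (nat \<Rightarrow> (real ^ 'n1) \<times> (real ^ 'n2))
     \<Rightarrow> (nat \<Rightarrow> (real ^ 'm) \<times> (real ^ 'm)) \<Rightarrow> bool" where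
  "feedback \<tau> \<mu>1 \<mu>2 P S r x y \<longleftrightarrow>
     sampled \<tau> P (\<lambda>k. fst (r k) - snd (y k)) (\<lambda>k. fst (x k)) (\<lambda>k. fst (y k))
   \<and> quantized_sampled \<tau> \<mu>1 \<mu>2 S (\<lambda>k. snd (r k) + fst (y k)) (\<lambda>k. snd (x k)) (\<lambda>k. snd (y k))"

end

theory Submission
  imports Defs
begin

text \<open>
  Dissipation inequalities add up: the supply rate of the loop is the sum of the supply rates of the
  two blocks, because the interconnection terms \<open>- z \<bullet> y\<^sub>1\<close> and \<open>y\<^sub>1 \<bullet> z\<close> cancel. So the theorem
  needs three estimates: what sampling costs, what quantization costs, and how a bound in the
  internal inputs of the loop turns into one in the external inputs.

  \<^bold>\<open>Sampling.\<close> On one sampling interval the input \<open>u\<close> is constant, so the continuous-time output \<open>y(t)\<close>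
  differs from the sample \<open>y[k]\<close> only by the drift \<open>d\<close> of the state part \<open>h\<^sub>1\<close>, and Cauchy-Schwarz
  gives \<open>|d|\<^sup>2 \<le> \<tau> D\<^sub>k\<close> with \<open>D\<^sub>k\<close> the integral of \<open>|dh\<^sub>1/dt|\<^sup>2\<close> over the interval. The bound on the
  output rate is not available per interval, where it would cost one \<open>\<beta>\<close> term each time; it
  must be applied once, to the trajectory glued from all the pieces
  (\<open>trajectory_glue\<close>, \<open>intersample_output_drift\<close>). This bounds \<open>\<Sum>\<^sub>k D\<^sub>k\<close> by
  \<open>\<gamma>\<^sup>2 \<tau> \<Sum>\<^sub>k |u[k]|\<^sup>2 + \<beta>(x[k\<^sub>0])\<close>. The dissipation inequality, in contrast, is used on each interval
  separately, and Young's inequality moves the drift into the indices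
  (\<open>one_step_dissipation\<close>, \<open>sampled_dissipation\<close>).

  \<^bold>\<open>Quantization.\<close> With \<open>u = v + a\<close> and \<open>y = z + b\<close>, the product \<open>u \<bullet> y\<close> contains the second-order term
  \<open>a \<bullet> b\<close>, for which \<open>\<delta>2t\<close> has no room. It is absorbed by writing
  \<open>u \<bullet> y = v \<bullet> z + u \<bullet> b + a \<bullet> z\<close> and using that the quantizer rounds towards zero, so that
  \<open>|u| \<le> |v|\<close> (\<open>quantized_supply_le\<close>).

  \<^bold>\<open>Feedback.\<close> The internal input \<open>r\<^sub>1 - z\<close> is traded against \<open>r\<^sub>1\<close> and \<open>z\<close> by completing a square; this
  is where the fractions in the bound on \<open>\<rho>h\<close> come from (\<open>input_index_transfer\<close>).
\<close>

section \<open>Zero-order hold and concatenation of trajectories\<close>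

lemma sampling_interval_exists:
  assumes "0 < \<tau>" "0 \<le> (t::real)"
  obtains k :: nat where "real k * \<tau> \<le> t" "t < (real k + 1) * \<tau>"
proof
  have n: "real (nat \<lfloor>t / \<tau>\<rfloor>) = of_int \<lfloor>t / \<tau>\<rfloor>" using assms by simp
  have "of_int \<lfloor>t / \<tau>\<rfloor> \<le> t / \<tau>" "t / \<tau> < of_int \<lfloor>t / \<tau>\<rfloor> + 1" by linarith+
  then show "real (nat \<lfloor>t / \<tau>\<rfloor>) * \<tau> \<le> t" "t < (real (nat \<lfloor>t / \<tau>\<rfloor>) + 1) * \<tau>"
    using assms unfolding n by (simp_all only: pos_le_divide_eq pos_divide_less_eq)
qed

lemma sampling_index_eq:
  assumes "0 < \<tau>" "real k * \<tau> \<le> t" "t < (real k + 1) * \<tau>"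
  shows "nat \<lfloor>t / \<tau>\<rfloor> = k"
proof -
  have "\<lfloor>t / \<tau>\<rfloor> = int k"
    using assms by (simp add: floor_eq_iff pos_le_divide_eq pos_divide_less_eq)
  then show ?thesis by simp
qed

definition hold :: "real \<Rightarrow> (nat \<Rightarrow> 'a) \<Rightarrow> real \<Rightarrow> 'a" where
  "hold \<tau> w t = w (nat \<lfloor>t / \<tau>\<rfloor>)"

text \<open>
  The \<open>k\<close>-th piece is run on its own clock, which starts at \<open>0\<close> at time \<open>k \<tau>\<close>.
\<close>

definition glue :: "real \<Rightarrow> (nat \<Rightarrow> real \<Rightarrow> 'a) \<Rightarrow> real \<Rightarrow> 'a" where
  "glue \<tau> \<xi> t = hold \<tau> \<xi> t (t - real (nat \<lfloor>t / \<tau>\<rfloor>) * \<tau>)"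

lemma hold_eq:
  assumes "0 < \<tau>" "real k * \<tau> \<le> t" "t < (real k + 1) * \<tau>"
  shows "hold \<tau> w t = w k"
  using sampling_index_eq[OF assms] by (simp add: hold_def)

text \<open>
  The endpoint \<open>(k + 1) \<tau>\<close> belongs to piece \<open>Suc k\<close> by definition; the matching condition
  makes the formula for piece \<open>k\<close> valid there as well, so consecutive pieces overlap and the
  gluing is continuous.
\<close>

lemma glue_eq:
  assumes "0 < \<tau>" "\<And>k. \<xi> (Suc k) 0 = \<xi> k \<tau>" "real k * \<tau> \<le> t" "t \<le> (real k + 1) * \<tau>"
  shows "glue \<tau> \<xi> t = \<xi> k (t - real k * \<tau>)"
proof (cases "t = (real k + 1) * \<tau>")
  case True
  have "nat \<lfloor>t / \<tau>\<rfloor> = Suc k"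
    using assms(1) by (intro sampling_index_eq) (simp_all add: True algebra_simps)
  then show ?thesis
    using assms(1,2) by (simp add: glue_def hold_def True algebra_simps)
next
  case False
  then have "nat \<lfloor>t / \<tau>\<rfloor> = k" using assms by (intro sampling_index_eq) auto
  then show ?thesis by (simp add: glue_def hold_def)
qed

text \<open>
  A held signal is locally constant except at the sampling times, of which only finitely many lie
  in a bounded interval, and its one-sided limits are samples again.
\<close>

lemma hold_admissible:
  assumes \<tau>: "0 < \<tau>" and w: "\<And>k. w k \<in> input_set S"
  shows "hold \<tau> w \<in> admissible_inputs S"
proof -
  have const_near: "eventually (\<lambda>s. hold \<tau> w s = w k) (nhds t)"
    if "real k * \<tau> < t" "t < (real k + 1) * \<tau>" for k t
  proof -
    have "eventually (\<lambda>s. s \<in> {real k * \<tau><..<(real k + 1) * \<tau>}) (nhds t)"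
      using that by (intro eventually_nhds_in_open) auto
    then show ?thesis by eventually_elim (use \<tau> in \<open>auto intro: hold_eq\<close>)
  qed
  have cont: "continuous (at t within {0..}) (hold \<tau> w)"
    if "real k * \<tau> < t" "t < (real k + 1) * \<tau>" for k t
  proof -
    have "isCont (hold \<tau> w) t \<longleftrightarrow> isCont (\<lambda>_. w k) t"
      by (rule isCont_cong) (rule const_near[OF that])
    then show ?thesis by (simp add: continuous_at_imp_continuous_at_within)
  qed
  have "finite {t \<in> {0..T}. \<not> continuous (at t within {0..}) (hold \<tau> w)}" if T: "T > 0" for T
  proof -
    obtain K where K: "T < (real K + 1) * \<tau>"
      using sampling_interval_exists[OF \<tau>, of T] T by auto
    have "{t \<in> {0..T}. \<not> continuous (at t within {0..}) (hold \<tau> w)} \<subseteq> (\<lambda>k. real k * \<tau>) ` {..K}"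
    proof safe
      fix t assume t: "t \<in> {0..T}" "\<not> continuous (at t within {0..}) (hold \<tau> w)"
      obtain k where k: "real k * \<tau> \<le> t" "t < (real k + 1) * \<tau>"
        using sampling_interval_exists[OF \<tau>, of t] t by auto
      have "real k * \<tau> < (real K + 1) * \<tau>" using k K t by auto
      then have "k \<le> K" using \<tau> by simp
      moreover have "t = real k * \<tau>" using cont[of k t] k t by force
      ultimately show "t \<in> (\<lambda>k. real k * \<tau>) ` {..K}" by auto
    qed
    then show ?thesis by (rule finite_subset) simp
  qed
  moreover have "\<exists>l \<in> input_set S. (hold \<tau> w \<longlongrightarrow> l) (at_right t)" if t: "t \<ge> 0" for t
  proof -
    obtain k where k: "real k * \<tau> \<le> t" "t < (real k + 1) * \<tau>"
      using sampling_interval_exists[OF \<tau>, of t] t by auto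
    have "eventually (\<lambda>s. s \<in> {t<..<(real k + 1) * \<tau>}) (at_right t)"
      using k by (intro eventually_at_right_real) auto
    then have "eventually (\<lambda>s. hold \<tau> w s = w k) (at_right t)"
      by eventually_elim (use \<tau> k in \<open>auto intro!: hold_eq\<close>)
    then show ?thesis using w tendsto_eventually by blast
  qed
  moreover have "\<exists>l \<in> input_set S. (hold \<tau> w \<longlongrightarrow> l) (at_left t)" if "t > 0" for t
  proof -
    \<comment> \<open>For a left limit the relevant interval is half-open on the other side: a sampling time
      belongs to the interval that it ends.\<close>
    obtain k where k: "real k * \<tau> < t" "t \<le> (real k + 1) * \<tau>"
    proof -
      obtain j where j: "real j * \<tau> \<le> t" "t < (real j + 1) * \<tau>"
        using sampling_interval_exists[OF \<tau>, of t] \<open>t > 0\<close> by auto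
      show ?thesis
      proof (cases "t = real j * \<tau>")
        case True
        then obtain i where "j = Suc i" using \<open>t > 0\<close> by (cases j) auto
        then show ?thesis using that[of i] True \<tau> by (auto simp: algebra_simps)
      next
        case False
        then show ?thesis using that[of j] j by auto
      qed
    qed
    have "eventually (\<lambda>s. s \<in> {real k * \<tau><..<t}) (at_left t)"
      using k by (intro eventually_at_left_real) auto
    then have "eventually (\<lambda>s. hold \<tau> w s = w k) (at_left t)"
      by eventually_elim (use \<tau> k in \<open>auto intro!: hold_eq\<close>)
    then show ?thesis using w tendsto_eventually by blast
  qed
  moreover have "hold \<tau> w t \<in> input_set S" for t using w by (simp add: hold_def)
  ultimately show ?thesis by (auto simp: admissible_inputs_def)
qed

lemma const_admissible:
  assumes "c \<in> input_set S"
  shows "(\<lambda>_. c) \<in> admissible_inputs S"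
  using assms by (auto simp: admissible_inputs_def)

lemma continuous_on_glue:
  fixes \<xi> :: "nat \<Rightarrow> real \<Rightarrow> 'a::metric_space"
  assumes \<tau>: "0 < \<tau>" and join: "\<And>k. \<xi> (Suc k) 0 = \<xi> k \<tau>"
    and \<xi>: "\<And>k. continuous_on {0..} (\<xi> k)"
  shows "continuous_on {0..} (glue \<tau> \<xi>)"
proof -
  have piece: "continuous_on {real k * \<tau>..(real k + 1) * \<tau>} (glue \<tau> \<xi>)" for k
  proof -
    have "continuous_on {real k * \<tau>..(real k + 1) * \<tau>} (\<lambda>t. \<xi> k (t - real k * \<tau>))"
      by (rule continuous_on_compose2[OF \<xi>]) (auto intro!: continuous_intros)
    then show ?thesis
      using glue_eq[where \<xi>=\<xi>, OF \<tau> join] by (subst continuous_on_cong[OF refl]) auto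
  qed
  have upto: "continuous_on {0..real K * \<tau>} (glue \<tau> \<xi>)" for K
  proof (induction K)
    case (Suc K)
    have "{0..real (Suc K) * \<tau>} = {0..real K * \<tau>} \<union> {real K * \<tau>..(real K + 1) * \<tau>}"
      using \<tau> by (subst ivl_disj_un_two_touch) (auto simp: algebra_simps)
    then show ?case
      using continuous_on_closed_Un[OF _ _ Suc.IH piece] by simp
  qed simp
  have "continuous (at t within {0..}) (glue \<tau> \<xi>)" if t: "t \<ge> 0" for t
  proof -
    obtain k where k: "t < (real k + 1) * \<tau>" using sampling_interval_exists[OF \<tau> t] by auto
    have "at t within {0..} = at t within {0..real (Suc k) * \<tau>}"
      by (rule at_within_nhd[of t "{..<real (Suc k) * \<tau>}"]) (use k t in \<open>auto simp: add.commute\<close>)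
    then show ?thesis
      using upto[of "Suc k"] t k by (simp add: continuous_on_eq_continuous_within add.commute)
  qed
  then show ?thesis by (simp add: continuous_on_eq_continuous_within)
qed

text \<open>
  This is where the exceptional set in the definition of a trajectory is needed: the glued
  trajectory inherits the exceptional times of its pieces, and adds the sampling times.
\<close>

lemma trajectory_glue:
  assumes \<tau>: "0 < \<tau>" and join: "\<And>k. \<xi> (Suc k) 0 = \<xi> k \<tau>"
    and \<xi>: "\<And>k. trajectory S (\<lambda>_. w k) (\<xi> k)"
  shows "trajectory S (hold \<tau> w) (glue \<tau> \<xi>)"
  unfolding trajectory_def
proof (intro conjI allI impI)
  show "continuous_on {0..} (glue \<tau> \<xi>)"
    using \<xi> by (intro continuous_on_glue[where \<xi>=\<xi>, OF \<tau> join]) (auto simp: trajectory_def)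
next
  fix T :: real assume "T > 0"
  have "\<exists>N. finite N \<and> (\<forall>s \<in> {0..\<tau>} - N.
      (\<xi> k has_vector_derivative dyn S (\<xi> k s) (w k)) (at s within {0..\<tau>}))" for k
    using \<xi>[of k] \<tau> by (auto simp: trajectory_def)
  then obtain N where N: "\<And>k. finite (N k)"
    "\<And>k s. s \<in> {0..\<tau>} - N k \<Longrightarrow>
      (\<xi> k has_vector_derivative dyn S (\<xi> k s) (w k)) (at s within {0..\<tau>})"
    by metis
  obtain K where K: "T < (real K + 1) * \<tau>"
    using sampling_interval_exists[OF \<tau>, of T] \<open>T > 0\<close> by auto
  define M where "M = (\<Union>k\<le>K. (\<lambda>s. s + real k * \<tau>) ` (insert 0 (N k)))"
  have "(glue \<tau> \<xi> has_vector_derivative dyn S (glue \<tau> \<xi> t) (hold \<tau> w t)) (at t within {0..T})"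
    if t: "t \<in> {0..T} - M" for t
  proof -
    obtain k where k: "real k * \<tau> \<le> t" "t < (real k + 1) * \<tau>"
      using sampling_interval_exists[OF \<tau>, of t] t by auto
    have "real k * \<tau> < (real K + 1) * \<tau>" using k K t by auto
    then have "k \<le> K" using \<tau> by simp
    define s where "s = t - real k * \<tau>"
    have s_notin: "s \<notin> insert 0 (N k)"
    proof
      assume "s \<in> insert 0 (N k)"
      then have "s + real k * \<tau> \<in> M" using \<open>k \<le> K\<close> unfolding M_def by blast
      then show False using t by (simp add: s_def)
    qed
    then have s: "s \<in> {0<..<\<tau>}" using k by (auto simp: s_def algebra_simps)
    have "(\<xi> k has_vector_derivative dyn S (\<xi> k s) (w k)) (at s within {0..\<tau>})"
      using N(2)[of s k] s s_notin by auto
    moreover have "at s within {0..\<tau>} = at s" using s by (intro at_within_interior) auto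
    ultimately have "(\<xi> k has_vector_derivative dyn S (\<xi> k s) (w k)) (at (t - real k * \<tau>))"
      by (simp add: s_def)
    then have "((\<lambda>t. \<xi> k (t - real k * \<tau>)) has_vector_derivative dyn S (\<xi> k s) (w k)) (at t)"
      using vector_diff_chain_at[of "\<lambda>t. t - real k * \<tau>" 1 t "\<xi> k"]
        has_vector_derivative_diff[OF has_vector_derivative_id has_vector_derivative_const]
      by (auto simp: o_def)
    then have "(glue \<tau> \<xi> has_vector_derivative dyn S (\<xi> k s) (w k)) (at t)"
    proof (rule has_vector_derivative_transform_within_open[of _ _ _ "{real k * \<tau><..<(real k + 1) * \<tau>}"])
      show "t \<in> {real k * \<tau><..<(real k + 1) * \<tau>}" using s by (auto simp: s_def algebra_simps)
    qed (auto intro!: glue_eq[where \<xi>=\<xi>, OF \<tau> join, symmetric])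
    moreover have "hold \<tau> w t = w k" using hold_eq[OF \<tau>] k by auto
    moreover have "glue \<tau> \<xi> t = \<xi> k s" using glue_eq[where \<xi>=\<xi>, OF \<tau> join] k by (auto simp: s_def)
    ultimately show ?thesis by (simp add: has_vector_derivative_at_within)
  qed
  moreover have "finite M" using N by (simp add: M_def)
  ultimately show "\<exists>N. finite N \<and> (\<forall>t \<in> {0..T} - N.
     (glue \<tau> \<xi> has_vector_derivative dyn S (glue \<tau> \<xi> t) (hold \<tau> w t)) (at t within {0..T}))"
    by blast
qed

section \<open>Drift of the output between samples\<close>

lemma has_integral_sampling_intervals:
  fixes f :: "real \<Rightarrow> 'a::banach"
  assumes \<tau>: "0 < \<tau>"
    and f: "\<And>k. k < N \<Longrightarrow> (f has_integral I k) {real k * \<tau>..(real k + 1) * \<tau>}"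
  shows "(f has_integral (\<Sum>k<N. I k)) {0..real N * \<tau>}"
  using f
proof (induction N)
  case (Suc N)
  have "(f has_integral (\<Sum>k<N. I k) + I N) {0..(real N + 1) * \<tau>}"
    using \<tau> Suc by (intro has_integral_combine[of 0 "real N * \<tau>"]) auto
  then show ?case by (simp add: add.commute)
qed (simp add: has_integral_refl)

text \<open>
  The Cauchy-Schwarz inequality for \<open>g b - g a\<close>, the integral of \<open>g'\<close>: the square
  \<open>|g' t - (g b - g a) / (b - a)|\<^sup>2\<close> of the deviation of \<open>g'\<close> from its mean has a nonnegative integral.
\<close>

lemma norm_increment_squared_le:
  fixes g :: "real \<Rightarrow> 'a::euclidean_space"
  assumes "a \<le> b" and cont: "continuous_on {a..b} g" and fin: "finite N"
    and deriv: "\<And>t. t \<in> {a<..<b} - N \<Longrightarrow> (g has_vector_derivative g' t) (at t)"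
    and int: "(\<lambda>t. (norm (g' t))\<^sup>2) integrable_on {a..b}"
  shows "(norm (g b - g a))\<^sup>2 \<le> (b - a) * integral {a..b} (\<lambda>t. (norm (g' t))\<^sup>2)"
proof (cases "a = b")
  case False
  then have ab: "a < b" using \<open>a \<le> b\<close> by simp
  define c where "c = g b - g a"
  define J where "J = integral {a..b} (\<lambda>t. (norm (g' t))\<^sup>2)"
  have g': "(g' has_integral c) {a..b}"
    unfolding c_def
    by (rule fundamental_theorem_of_calculus_interior_strong[OF fin \<open>a \<le> b\<close>])
      (use deriv cont in auto)
  have "((\<lambda>t. (norm (g' t))\<^sup>2 - 2 / (b - a) * (g' t \<bullet> c) + (norm c)\<^sup>2 / (b - a)\<^sup>2)
      has_integral (J - 2 / (b - a) * (c \<bullet> c) + (b - a) * ((norm c)\<^sup>2 / (b - a)\<^sup>2))) {a..b}"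
  proof (intro has_integral_add has_integral_diff has_integral_mult_right)
    show "((\<lambda>t. (norm (g' t))\<^sup>2) has_integral J) {a..b}" using int by (simp add: J_def has_integral_integral)
    show "((\<lambda>t. g' t \<bullet> c) has_integral c \<bullet> c) {a..b}"
      using has_integral_linear[OF g' bounded_linear_inner_left] by (simp add: o_def)
    show "((\<lambda>_. (norm c)\<^sup>2 / (b - a)\<^sup>2) has_integral (b - a) * ((norm c)\<^sup>2 / (b - a)\<^sup>2)) {a..b}"
      using has_integral_const_real[of "(norm c)\<^sup>2 / (b - a)\<^sup>2" a b] ab by simp
  qed
  moreover have "(norm (g' t))\<^sup>2 - 2 / (b - a) * (g' t \<bullet> c) + (norm c)\<^sup>2 / (b - a)\<^sup>2
      = (norm (g' t - c /\<^sub>R (b - a)))\<^sup>2" for t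
    unfolding power2_norm_eq_inner
    by (simp add: inner_diff_left inner_diff_right inner_commute divide_inverse power2_eq_square
        inverse_mult_distrib[symmetric] del: inverse_mult_distrib)
  ultimately have "0 \<le> J - 2 / (b - a) * (c \<bullet> c) + (b - a) * ((norm c)\<^sup>2 / (b - a)\<^sup>2)"
    by (auto intro: has_integral_nonneg)
  also have "\<dots> = J - (norm c)\<^sup>2 / (b - a)"
  proof -
    have "2 / L * (c \<bullet> c) - L * ((norm c)\<^sup>2 / L\<^sup>2) = (norm c)\<^sup>2 / L" if "L > 0" for L
      using that by (simp add: power2_norm_eq_inner[symmetric] field_simps power2_eq_square)
    from this[of "b - a"] ab show ?thesis by simp
  qed
  finally show ?thesis using ab by (simp add: c_def J_def field_simps)
qed simp


text \<open>
  The witness \<open>D k\<close> is the integral of the squared output rate over the \<open>k\<close>-th interval of the glued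
  trajectory. Only the glued trajectory gives a bound on the sum with a single term \<open>\<beta>\<close>.
\<close>

lemma intersample_output_drift:
  assumes \<tau>: "0 < \<tau>" and bounded: "output_rate_bounded S h1 \<gamma> \<beta>"
    and w: "\<And>k. w k \<in> input_set S"
    and join: "\<And>k. \<xi> (Suc k) 0 = \<xi> k \<tau>"
    and \<xi>: "\<And>k. trajectory S (\<lambda>_. w k) (\<xi> k)"
  obtains D where
    "\<And>k t. k < N \<Longrightarrow> t \<in> {0..\<tau>} \<Longrightarrow> (norm (h1 (\<xi> k t) - h1 (\<xi> k 0)))\<^sup>2 \<le> \<tau> * D k"
    "(\<Sum>k<N. D k) \<le> \<gamma>\<^sup>2 * \<tau> * (\<Sum>k<N. (norm (w k))\<^sup>2) + \<beta> (\<xi> 0 0)"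
proof (cases "N = 0")
  case True
  then show ?thesis using bounded that[of "\<lambda>_. 0"] by (simp add: output_rate_bounded_def)
next
  case False
  define T where "T = real N * \<tau>"
  have "T > 0" using False \<tau> by (simp add: T_def)
  define X where "X = glue \<tau> \<xi>"
  define dh where "dh = (\<lambda>t. vector_derivative (h1 \<circ> X) (at t within {0..T}))"
  define D where "D k = integral {real k * \<tau>..(real k + 1) * \<tau>} (\<lambda>t. (norm (dh t))\<^sup>2)" for k
  have X_eq: "X t = \<xi> k (t - real k * \<tau>)" if "real k * \<tau> \<le> t" "t \<le> (real k + 1) * \<tau>" for k t
    unfolding X_def using that \<tau> join by (intro glue_eq)
  have "hold \<tau> w \<in> admissible_inputs S" using \<tau> w by (rule hold_admissible)
  moreover have "trajectory S (hold \<tau> w) X"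
    unfolding X_def using \<tau> join \<xi> by (rule trajectory_glue)
  ultimately have pw: "(h1 \<circ> X) piecewise_differentiable_on {0..T}"
    and int: "(\<lambda>t. (norm (dh t))\<^sup>2) integrable_on {0..T}"
    and le: "integral {0..T} (\<lambda>t. (norm (dh t))\<^sup>2)
        \<le> \<gamma>\<^sup>2 * integral {0..T} (\<lambda>t. (norm (hold \<tau> w t))\<^sup>2) + \<beta> (X 0)"
    using bounded \<open>T > 0\<close> by (auto simp: output_rate_bounded_def dh_def Let_def)
  obtain M where M: "finite M" "\<And>t. t \<in> {0..T} - M \<Longrightarrow> (h1 \<circ> X) differentiable (at t within {0..T})"
    and cont: "continuous_on {0..T} (h1 \<circ> X)"
    using pw by (auto simp: piecewise_differentiable_on_def)
  have deriv: "((h1 \<circ> X) has_vector_derivative dh t) (at t)" if "t \<in> {0<..<T} - M" for t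
  proof -
    have "((h1 \<circ> X) has_vector_derivative dh t) (at t within {0..T})"
      using M(2)[of t] that unfolding dh_def by (simp add: vector_derivative_works)
    moreover have "at t within {0..T} = at t" using that by (intro at_within_interior) auto
    ultimately show ?thesis by simp
  qed
  have sub: "{real k * \<tau>..(real k + 1) * \<tau>} \<subseteq> {0..T}" if "k < N" for k
  proof -
    have "(real k + 1) * \<tau> \<le> T" using that \<tau> by (simp add: T_def)
    then show ?thesis using \<tau> by auto
  qed
  show ?thesis
  proof (rule that[of D])
    fix k t assume k: "k < N" and t: "t \<in> {0..\<tau>}"
    define a where "a = real k * \<tau>"
    have sub_k: "{a..a + t} \<subseteq> {real k * \<tau>..(real k + 1) * \<tau>}"
      using t by (auto simp: a_def algebra_simps)
    have int_k: "(\<lambda>t. (norm (dh t))\<^sup>2) integrable_on {real k * \<tau>..(real k + 1) * \<tau>}"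
      using integrable_on_subinterval[OF int sub[OF k]] .
    have int_t: "(\<lambda>t. (norm (dh t))\<^sup>2) integrable_on {a..a + t}"
      using integrable_on_subinterval[OF int_k sub_k] .
    have "(norm ((h1 \<circ> X) (a + t) - (h1 \<circ> X) a))\<^sup>2
        \<le> (a + t - a) * integral {a..a + t} (\<lambda>t. (norm (dh t))\<^sup>2)"
    proof (rule norm_increment_squared_le[OF _ _ M(1) _ int_t])
      show "continuous_on {a..a + t} (h1 \<circ> X)"
        using sub_k sub[OF k] by (intro continuous_on_subset[OF cont]) auto
      have "{a<..<a + t} \<subseteq> {0<..<T}"
      proof (cases "t = 0")
        case False
        have "{a..a + t} \<subseteq> {0..T}" using sub_k sub[OF k] by blast
        then show ?thesis using t by auto
      qed simp
      then show "((h1 \<circ> X) has_vector_derivative dh s) (at s)" if "s \<in> {a<..<a + t} - M" for s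
        using deriv that by blast
    qed (use t in auto)
    also have "\<dots> \<le> \<tau> * D k"
      unfolding D_def using t \<tau> int_k int_t sub_k
      by (intro mult_mono integral_subset_le integral_nonneg) auto
    finally show "(norm (h1 (\<xi> k t) - h1 (\<xi> k 0)))\<^sup>2 \<le> \<tau> * D k"
      using t \<tau> X_eq[of k a] X_eq[of k "a + t"] by (simp add: a_def algebra_simps)
  next
    have "((\<lambda>t. (norm (dh t))\<^sup>2) has_integral (\<Sum>k<N. D k)) {0..T}"
      unfolding T_def D_def using integrable_on_subinterval[OF int sub]
      by (intro has_integral_sampling_intervals[OF \<tau>]) (auto simp: has_integral_integral)
    moreover have "((\<lambda>t. (norm (hold \<tau> w t))\<^sup>2) has_integral (\<Sum>k<N. \<tau> * (norm (w k))\<^sup>2)) {0..T}"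
      unfolding T_def
    proof (rule has_integral_sampling_intervals[OF \<tau>])
      fix k
      have "((\<lambda>t. (norm (w k))\<^sup>2) has_integral \<tau> * (norm (w k))\<^sup>2) {real k * \<tau>..(real k + 1) * \<tau>}"
        using has_integral_const_real[of "(norm (w k))\<^sup>2" "real k * \<tau>" "(real k + 1) * \<tau>"] \<tau>
        by (simp add: algebra_simps)
      \<comment> \<open>At the right endpoint the held signal already has its next value.\<close>
      then show "((\<lambda>t. (norm (hold \<tau> w t))\<^sup>2) has_integral \<tau> * (norm (w k))\<^sup>2)
          {real k * \<tau>..(real k + 1) * \<tau>}"
        by (rule has_integral_spike_finite[of "{(real k + 1) * \<tau>}", rotated 2])
          (auto simp: hold_eq[OF \<tau>])
    qed
    moreover have "X 0 = \<xi> 0 0" using X_eq[of 0 0] \<tau> by simp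
    ultimately show "(\<Sum>k<N. D k) \<le> \<gamma>\<^sup>2 * \<tau> * (\<Sum>k<N. (norm (w k))\<^sup>2) + \<beta> (\<xi> 0 0)"
      using le by (simp add: integral_unique sum_distrib_left mult.assoc)
  qed
qed

section \<open>Dissipativity of the sampled system\<close>

lemma young_inner:
  fixes a b :: "'a::real_inner"
  assumes "0 < c"
  shows "a \<bullet> b \<le> c * (norm a)\<^sup>2 + (norm b)\<^sup>2 / (4 * c)"
proof -
  have "0 \<le> (norm ((2 * c) *\<^sub>R a - b))\<^sup>2" by simp
  also have "\<dots> = 4 * c * (c * (norm a)\<^sup>2 + (norm b)\<^sup>2 / (4 * c) - a \<bullet> b)"
    using assms unfolding power2_norm_eq_inner
    by (simp add: inner_diff_left inner_diff_right inner_commute field_simps power2_eq_square)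
  finally show ?thesis using assms by (simp add: zero_le_mult_iff)
qed

text \<open>
  The sign of \<open>\<rho>\<close> is arbitrary, so the cross term \<open>2 (y \<bullet> d)\<close> has to be bounded from both sides; this
  is why \<open>\<bar>\<rho>\<bar>\<close> appears.
\<close>

lemma norm_squared_perturbed:
  fixes y d :: "'a::real_inner"
  assumes "0 < l"
  shows "- \<rho> * (norm (y + d))\<^sup>2 \<le> - (\<rho> - \<bar>\<rho>\<bar> / l) * (norm y)\<^sup>2 + \<bar>\<rho>\<bar> * (1 + l) * (norm d)\<^sup>2"
proof -
  have X: "(norm (y + d))\<^sup>2 = (norm y)\<^sup>2 + 2 * (y \<bullet> d) + (norm d)\<^sup>2"
    unfolding power2_norm_eq_inner by (simp add: inner_add_left inner_add_right inner_commute)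
  have "2 * (y \<bullet> d) \<le> (norm y)\<^sup>2 / l + l * (norm d)\<^sup>2" "- (2 * (y \<bullet> d)) \<le> (norm y)\<^sup>2 / l + l * (norm d)\<^sup>2"
    using young_inner[of "l / 2" d y] young_inner[of "l / 2" d "- y"] assms
    by (simp_all add: inner_commute)
  moreover have "0 \<le> (norm d)\<^sup>2" by simp
  ultimately have "(norm (y + d))\<^sup>2 \<le> (norm y)\<^sup>2 + (norm y)\<^sup>2 / l + ((norm d)\<^sup>2 + l * (norm d)\<^sup>2)"
    "- (norm (y + d))\<^sup>2 \<le> - (norm y)\<^sup>2 + (norm y)\<^sup>2 / l + ((norm d)\<^sup>2 + l * (norm d)\<^sup>2)"
    unfolding X by linarith+
  then have "(norm (y + d))\<^sup>2 \<le> (1 + 1 / l) * (norm y)\<^sup>2 + (1 + l) * (norm d)\<^sup>2"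
    "- (norm (y + d))\<^sup>2 \<le> - (1 - 1 / l) * (norm y)\<^sup>2 + (1 + l) * (norm d)\<^sup>2"
    by (simp_all add: algebra_simps)
  from this[THEN mult_left_mono, OF abs_ge_zero[of \<rho>]]
  have *: "\<bar>\<rho>\<bar> * (norm (y + d))\<^sup>2 \<le> \<bar>\<rho>\<bar> * ((1 + 1 / l) * (norm y)\<^sup>2 + (1 + l) * (norm d)\<^sup>2)"
    "\<bar>\<rho>\<bar> * - (norm (y + d))\<^sup>2 \<le> \<bar>\<rho>\<bar> * (- (1 - 1 / l) * (norm y)\<^sup>2 + (1 + l) * (norm d)\<^sup>2)"
    .
  show ?thesis
  proof (cases "\<rho> \<ge> 0")
    case True
    then show ?thesis using *(2) by (simp add: algebra_simps)
  next
    case False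
    then show ?thesis using *(1) by (simp add: algebra_simps)
  qed
qed

text \<open>
  Along the interval only the drift of the output varies, and its bound is uniform in time; so the
  supply rate has a constant pointwise bound, which is integrated.
\<close>

lemma one_step_dissipation:
  assumes \<tau>: "0 < \<tau>" and sys: "control_system S" and dissip: "IF_OFP S V \<nu> \<rho>"
    and u: "u \<in> input_set S" and \<xi>: "trajectory S (\<lambda>_. u) \<xi>"
    and y: "y = out S (\<xi> 0) u" and "0 < \<gamma>" "0 < l"
    and drift: "\<And>t. t \<in> {0..\<tau>} \<Longrightarrow> (norm (out S (\<xi> t) u - y))\<^sup>2 \<le> \<tau> * D"
  shows "V (\<xi> \<tau>) - V (\<xi> 0)
    \<le> \<tau> * (u \<bullet> y - (\<nu> - \<tau> * \<gamma> / 2) * (norm u)\<^sup>2 - (\<rho> - \<bar>\<rho>\<bar> / l) * (norm y)\<^sup>2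
           + (1 / (2 * \<gamma>) + \<bar>\<rho>\<bar> * (1 + l) * \<tau>) * D)"
    (is "_ \<le> \<tau> * ?C")
proof -
  define g where "g s = u \<bullet> out S (\<xi> s) u - \<nu> * (norm u)\<^sup>2 - \<rho> * (norm (out S (\<xi> s) u))\<^sup>2" for s
  have "V (\<xi> \<tau>) - V (\<xi> 0) \<le> integral {0..\<tau>} g"
    using dissip const_admissible[OF u] \<xi> \<tau> by (auto simp: IF_OFP_def g_def[abs_def])
  also have "\<dots> \<le> integral {0..\<tau>} (\<lambda>_. ?C)"
  proof (rule integral_le)
    have "continuous_on {0..\<tau>} \<xi>"
      using \<xi> by (auto simp: trajectory_def intro: continuous_on_subset)
    then have "continuous_on {0..\<tau>} (\<lambda>s. (\<xi> s, u))" by (intro continuous_intros)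
    moreover have "continuous_on (UNIV \<times> input_set S) (\<lambda>(x, u). out S x u)"
      using sys by (simp add: control_system_def)
    ultimately have "continuous_on {0..\<tau>} (\<lambda>s. out S (\<xi> s) u)"
      using continuous_on_compose2[of "UNIV \<times> input_set S" "\<lambda>(x, u). out S x u"
          "{0..\<tau>}" "\<lambda>s. (\<xi> s, u)"] u by auto
    then show "g integrable_on {0..\<tau>}"
      unfolding g_def by (intro integrable_continuous_real continuous_intros) auto
  next
    fix t assume t: "t \<in> {0..\<tau>}"
    define d where "d = out S (\<xi> t) u - y"
    have out_eq: "out S (\<xi> t) u = y + d" by (simp add: d_def)
    have d: "(norm d)\<^sup>2 \<le> \<tau> * D" using drift[OF t] by (simp add: d_def)
    \<comment> \<open>The weight \<open>\<tau> \<gamma> / 2\<close> balances the two terms: after summation, \<open>D\<close> contributes about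
      \<open>\<gamma>\<^sup>2 \<tau> |u|\<^sup>2\<close>, so that each of them costs \<open>\<tau> \<gamma> / 2\<close> in the input index.\<close>
    have "u \<bullet> d \<le> \<tau> * \<gamma> / 2 * (norm u)\<^sup>2 + (norm d)\<^sup>2 / (2 * \<tau> * \<gamma>)"
      using young_inner[of "\<tau> * \<gamma> / 2" u d] \<tau> \<open>0 < \<gamma>\<close> by (simp add: mult_ac)
    also have "(norm d)\<^sup>2 / (2 * \<tau> * \<gamma>) \<le> \<tau> * D / (2 * \<tau> * \<gamma>)"
      using d \<tau> \<open>0 < \<gamma>\<close> by (intro divide_right_mono) auto
    also have "\<dots> = 1 / (2 * \<gamma>) * D" using \<tau> by simp
    finally have 1: "u \<bullet> d \<le> \<tau> * \<gamma> / 2 * (norm u)\<^sup>2 + 1 / (2 * \<gamma>) * D" by simp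
    have "\<bar>\<rho>\<bar> * (1 + l) * (norm d)\<^sup>2 \<le> \<bar>\<rho>\<bar> * (1 + l) * (\<tau> * D)"
      using d \<open>0 < l\<close> by (intro mult_left_mono) auto
    then show "g t \<le> ?C"
      using 1 norm_squared_perturbed[OF \<open>0 < l\<close>, of \<rho> y d]
      unfolding g_def out_eq by (simp add: inner_add_right algebra_simps)
  qed auto
  also have "\<dots> = \<tau> * ?C" using \<tau> by simp
  finally show ?thesis .
qed

lemma sampled_shift:
  "sampled \<tau> S u x y \<Longrightarrow> sampled \<tau> S (\<lambda>k. u (k0 + k)) (\<lambda>k. x (k0 + k)) (\<lambda>k. y (k0 + k))"
  unfolding sampled_def by (metis add_Suc_right)

text \<open>
  Summing the one-step inequalities, the drift terms are bounded together: their coefficient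
  \<open>1 / (2 \<gamma>) + \<bar>\<rho>\<bar> (1 + l) \<tau>\<close> multiplies \<open>\<gamma>\<^sup>2 \<tau> \<Sum>\<^sub>k |u k|\<^sup>2\<close>, which lowers the input index, and
  \<open>\<beta> (x k0)\<close>, which becomes the initial offset.
\<close>

lemma sampled_dissipation:
  assumes \<tau>: "0 < \<tau>" and sys: "control_system S"
    and splits: "output_splits S h1 h2" and bounded: "output_rate_bounded S h1 \<gamma> \<beta>"
    and dissip: "IF_OFP S V \<nu> \<rho>" and l: "0 < l"
    and sampled: "sampled \<tau> S u x y" and "k0 \<le> k1"
  shows "1 / \<tau> * V (x k1) - 1 / \<tau> * V (x k0)
    \<le> (\<bar>\<rho>\<bar> * \<tau> * (1 + l) + 1 / \<gamma>) * \<beta> (x k0)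
       + (\<Sum>k = k0..<k1. u k \<bullet> y k
            - (\<nu> - \<tau> * \<gamma> - \<tau>\<^sup>2 * \<gamma>\<^sup>2 * (1 + l) * \<bar>\<rho>\<bar>) * (norm (u k))\<^sup>2
            - (\<rho> - \<bar>\<rho>\<bar> / l) * (norm (y k))\<^sup>2)"
proof -
  have \<gamma>: "\<gamma> > 0" and \<beta>: "\<beta> z \<ge> 0" for z using bounded by (auto simp: output_rate_bounded_def)
  have from0: "1 / \<tau> * V (x N) - 1 / \<tau> * V (x 0)
    \<le> (\<bar>\<rho>\<bar> * \<tau> * (1 + l) + 1 / \<gamma>) * \<beta> (x 0)
       + (\<Sum>k<N. u k \<bullet> y k
            - (\<nu> - \<tau> * \<gamma> - \<tau>\<^sup>2 * \<gamma>\<^sup>2 * (1 + l) * \<bar>\<rho>\<bar>) * (norm (u k))\<^sup>2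
            - (\<rho> - \<bar>\<rho>\<bar> / l) * (norm (y k))\<^sup>2)"
    if smp: "sampled \<tau> S u x y" for N u x y
  proof -
    have u: "u k \<in> input_set S" and y: "y k = out S (x k) (u k)" for k
      using smp by (auto simp: sampled_def)
    obtain \<xi> where \<xi>: "\<And>k. trajectory S (\<lambda>_. u k) (\<xi> k)" "\<And>k. \<xi> k 0 = x k"
        "\<And>k. \<xi> k \<tau> = x (Suc k)"
    proof -
      have "\<forall>k. \<exists>\<xi>. trajectory S (\<lambda>_. u k) \<xi> \<and> \<xi> 0 = x k \<and> \<xi> \<tau> = x (Suc k)"
        using smp by (simp add: sampled_def)
      then show ?thesis using choice[of "\<lambda>k \<xi>. trajectory S (\<lambda>_. u k) \<xi> \<and> \<xi> 0 = x k \<and> \<xi> \<tau> = x (Suc k)"] that by blast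
    qed
    obtain D where D: "\<And>k t. k < N \<Longrightarrow> t \<in> {0..\<tau>} \<Longrightarrow> (norm (h1 (\<xi> k t) - h1 (\<xi> k 0)))\<^sup>2 \<le> \<tau> * D k"
      and sumD: "(\<Sum>k<N. D k) \<le> \<gamma>\<^sup>2 * \<tau> * (\<Sum>k<N. (norm (u k))\<^sup>2) + \<beta> (\<xi> 0 0)"
      using intersample_output_drift[where w = u and \<xi> = \<xi> and N = N, OF \<tau> bounded u] \<xi> by auto
    define c where "c = 1 / (2 * \<gamma>) + \<bar>\<rho>\<bar> * (1 + l) * \<tau>"
    define s where "s k = u k \<bullet> y k - (\<nu> - \<tau> * \<gamma> / 2) * (norm (u k))\<^sup>2
        - (\<rho> - \<bar>\<rho>\<bar> / l) * (norm (y k))\<^sup>2" for k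
    have "c \<ge> 0" using \<gamma> l \<tau> by (simp add: c_def)
    have step: "1 / \<tau> * V (x (Suc k)) - 1 / \<tau> * V (x k) \<le> s k + c * D k" if "k < N" for k
    proof -
      have "out S (\<xi> k t) (u k) - y k = h1 (\<xi> k t) - h1 (\<xi> k 0)" for t
        using splits u by (simp add: y \<xi> output_splits_def)
      then have "V (\<xi> k \<tau>) - V (\<xi> k 0) \<le> \<tau> * (s k + c * D k)"
        unfolding s_def c_def using D[OF that]
        by (intro one_step_dissipation[OF \<tau> sys dissip u \<xi>(1) _ \<gamma> l]) (auto simp: y \<xi>)
      then show ?thesis using \<tau> by (simp add: \<xi> field_simps)
    qed
    have "1 / \<tau> * V (x N) - 1 / \<tau> * V (x 0) = (\<Sum>k<N. 1 / \<tau> * V (x (Suc k)) - 1 / \<tau> * V (x k))"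
      using sum_lessThan_telescope[of "\<lambda>k. 1 / \<tau> * V (x k)" N] by simp
    also have "\<dots> \<le> (\<Sum>k<N. s k + c * D k)" using step by (intro sum_mono) auto
    also have "\<dots> = (\<Sum>k<N. s k) + c * (\<Sum>k<N. D k)" by (simp add: sum.distrib sum_distrib_left)
    also have "\<dots> \<le> (\<Sum>k<N. s k) + c * (\<gamma>\<^sup>2 * \<tau> * (\<Sum>k<N. (norm (u k))\<^sup>2) + \<beta> (x 0))"
      using sumD \<open>c \<ge> 0\<close> by (intro add_left_mono mult_left_mono) (auto simp: \<xi>)
    also have "\<dots> = c * \<beta> (x 0) + (\<Sum>k<N. s k + c * \<gamma>\<^sup>2 * \<tau> * (norm (u k))\<^sup>2)"
      by (simp add: sum.distrib sum_distrib_left algebra_simps)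
    also have "c * \<beta> (x 0) \<le> (\<bar>\<rho>\<bar> * \<tau> * (1 + l) + 1 / \<gamma>) * \<beta> (x 0)"
      using \<beta> \<gamma> by (intro mult_right_mono) (auto simp: c_def field_simps)
    also have "c * \<gamma>\<^sup>2 * \<tau> = \<tau> * \<gamma> / 2 + \<tau>\<^sup>2 * \<gamma>\<^sup>2 * (1 + l) * \<bar>\<rho>\<bar>"
      using \<gamma> by (simp add: c_def field_simps power2_eq_square)
    finally show ?thesis by (simp add: s_def algebra_simps)
  qed
  from from0[OF sampled_shift[OF sampled, of k0], of "k1 - k0"] \<open>k0 \<le> k1\<close>
  show ?thesis by (simp add: sum.atLeastLessThan_shift_0[of _ k0 k1] lessThan_atLeast0 comp_def)
qed

section \<open>Quantization\<close>

lemma quantize1_truncates: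
  assumes "0 < \<mu>"
  shows "\<bar>quantize1 \<mu> s\<bar> \<le> \<bar>s\<bar>" "\<bar>quantize1 \<mu> s - s\<bar> \<le> \<mu>"
proof -
  have fl: "of_int \<lfloor>s / \<mu>\<rfloor> * \<mu> \<le> s" "s < (of_int \<lfloor>s / \<mu>\<rfloor> + 1) * \<mu>"
    using assms by (simp_all only: pos_le_divide_eq[symmetric] pos_divide_less_eq[symmetric]) linarith+
  have ce: "s \<le> of_int \<lceil>s / \<mu>\<rceil> * \<mu>" "(of_int \<lceil>s / \<mu>\<rceil> - 1) * \<mu> < s"
    using assms by (simp_all only: pos_less_divide_eq[symmetric] pos_divide_le_eq[symmetric]) linarith+
  have "0 \<le> of_int \<lfloor>s / \<mu>\<rfloor> * \<mu>" if "0 \<le> s" using assms that by simp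
  moreover have "of_int \<lceil>s / \<mu>\<rceil> * \<mu> \<le> 0" if "s < 0"
    using assms that by (simp add: mult_le_0_iff divide_nonpos_pos)
  ultimately show "\<bar>quantize1 \<mu> s\<bar> \<le> \<bar>s\<bar>" "\<bar>quantize1 \<mu> s - s\<bar> \<le> \<mu>"
    using fl ce by (auto simp: quantize1_def algebra_simps)
qed

lemma norm_squared_vec: "(norm (v :: real ^ 'm))\<^sup>2 = (\<Sum>i\<in>UNIV. (v $ i)\<^sup>2)"
  unfolding power2_norm_eq_inner by (simp add: inner_vec_def power2_eq_square)

lemma quantize_norm_le:
  fixes v :: "real ^ 'm::finite"
  assumes "0 < \<mu>"
  shows "(norm (quantize \<mu> v))\<^sup>2 \<le> (norm v)\<^sup>2"
  unfolding norm_squared_vec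
  using quantize1_truncates(1)[OF assms] by (intro sum_mono) (simp add: quantize_def abs_le_square_iff)

lemma quantize_error_le:
  fixes v :: "real ^ 'm::finite"
  assumes "0 < \<mu>"
  shows "(norm (quantize \<mu> v - v))\<^sup>2 \<le> real CARD('m) * \<mu>\<^sup>2"
proof -
  have "(quantize1 \<mu> (v $ i) - v $ i)\<^sup>2 \<le> \<mu>\<^sup>2" for i
    using quantize1_truncates(2)[OF assms, of "v $ i"] assms by (subst abs_le_square_iff[symmetric]) auto
  then have "(\<Sum>i\<in>UNIV. ((quantize \<mu> v - v) $ i)\<^sup>2) \<le> (\<Sum>i\<in>(UNIV::'m set). \<mu>\<^sup>2)"
    by (intro sum_mono) (simp add: quantize_def)
  then show ?thesis by (simp add: norm_squared_vec)
qed

text \<open>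
  The cross terms are weighted with \<open>l24\<close> and \<open>l25\<close>, the squares with \<open>l23\<close> and \<open>l22\<close>. Splitting
  \<open>u \<bullet> y\<close> with the quantized input \<open>u\<close>, rather than \<open>v\<close>, next to the output error avoids a product
  of the two errors.
\<close>

lemma quantized_supply_le:
  fixes v y :: "real ^ 'm::finite" and \<mu>1 \<mu>2 :: real
  defines "u \<equiv> quantize \<mu>1 v" and "z \<equiv> quantize \<mu>2 y"
  assumes "0 < \<mu>1" "0 < \<mu>2" and l: "0 < l22" "0 < l23" "0 < l24" "0 < l25"
  shows "u \<bullet> y - \<nu> * (norm u)\<^sup>2 - \<rho> * (norm y)\<^sup>2
    \<le> v \<bullet> z - (\<nu> - \<bar>\<nu>\<bar> / l23 - 1 / (4 * l24)) * (norm v)\<^sup>2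
        - (\<rho> - \<bar>\<rho>\<bar> / l22 - 1 / (4 * l25)) * (norm z)\<^sup>2
        + ((\<bar>\<rho>\<bar> * (1 + l22) + l24) * real CARD('m) * \<mu>2\<^sup>2
           + (\<bar>\<nu>\<bar> * (1 + l23) + l25) * real CARD('m) * \<mu>1\<^sup>2)"
proof -
  define a b where "a = u - v" and "b = y - z"
  have a: "(norm a)\<^sup>2 \<le> real CARD('m) * \<mu>1\<^sup>2"
    using quantize_error_le[OF \<open>0 < \<mu>1\<close>, of v] by (simp add: a_def u_def)
  have b: "(norm b)\<^sup>2 \<le> real CARD('m) * \<mu>2\<^sup>2"
    using quantize_error_le[OF \<open>0 < \<mu>2\<close>, of y] by (simp add: b_def z_def norm_minus_commute)
  have uv: "(norm u)\<^sup>2 \<le> (norm v)\<^sup>2" using quantize_norm_le[OF \<open>0 < \<mu>1\<close>] by (simp add: u_def)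
  have split: "u \<bullet> y = v \<bullet> z + u \<bullet> b + a \<bullet> z"
    by (simp add: a_def b_def inner_diff_left inner_diff_right)
  have "u \<bullet> b \<le> 1 / (4 * l24) * (norm u)\<^sup>2 + l24 * (norm b)\<^sup>2"
    using young_inner[of l24 b u] l by (simp add: inner_commute)
  also have "\<dots> \<le> 1 / (4 * l24) * (norm v)\<^sup>2 + l24 * (norm b)\<^sup>2"
    using uv l by (intro add_right_mono mult_left_mono) auto
  finally have ub: "u \<bullet> b \<le> 1 / (4 * l24) * (norm v)\<^sup>2 + l24 * (norm b)\<^sup>2" .
  have az: "a \<bullet> z \<le> l25 * (norm a)\<^sup>2 + 1 / (4 * l25) * (norm z)\<^sup>2"
    using young_inner[of l25 a z] l by simp
  have u: "- \<nu> * (norm u)\<^sup>2 \<le> - (\<nu> - \<bar>\<nu>\<bar> / l23) * (norm v)\<^sup>2 + \<bar>\<nu>\<bar> * (1 + l23) * (norm a)\<^sup>2"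
    using norm_squared_perturbed[OF l(2), of \<nu> v a] by (simp add: a_def)
  have y: "- \<rho> * (norm y)\<^sup>2 \<le> - (\<rho> - \<bar>\<rho>\<bar> / l22) * (norm z)\<^sup>2 + \<bar>\<rho>\<bar> * (1 + l22) * (norm b)\<^sup>2"
    using norm_squared_perturbed[OF l(1), of \<rho> z b] by (simp add: b_def)
  have "(\<bar>\<rho>\<bar> * (1 + l22) + l24) * (norm b)\<^sup>2 \<le> (\<bar>\<rho>\<bar> * (1 + l22) + l24) * (real CARD('m) * \<mu>2\<^sup>2)"
    using b l by (intro mult_left_mono) auto
  moreover have "(\<bar>\<nu>\<bar> * (1 + l23) + l25) * (norm a)\<^sup>2 \<le> (\<bar>\<nu>\<bar> * (1 + l23) + l25) * (real CARD('m) * \<mu>1\<^sup>2)"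
    using a l by (intro mult_left_mono) auto
  ultimately show ?thesis using split ub az u y by (simp add: algebra_simps)
qed

section \<open>The feedback loop\<close>

text \<open>
  The difference of the two sides is \<open>|(\<nu> - \<kappa>) r - \<nu> z|\<^sup>2 / (\<nu> - \<kappa>)\<close>, and the
  coefficient \<open>\<kappa> \<nu> / (\<nu> - \<kappa>)\<close> of \<open>|z|\<^sup>2\<close> is the one that makes it a perfect square.
\<close>

lemma input_index_transfer:
  fixes r z :: "'a::real_inner"
  assumes "\<kappa> < \<nu>"
  shows "- \<nu> * (norm (r - z))\<^sup>2 \<le> - \<kappa> * (norm r)\<^sup>2 + \<kappa> * \<nu> / (\<nu> - \<kappa>) * (norm z)\<^sup>2"
proof -
  define e where "e = \<nu> - \<kappa>"
  have "e > 0" and \<kappa>: "\<kappa> = \<nu> - e" using assms by (simp_all add: e_def)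
  have diff: "(norm (r - z))\<^sup>2 = (norm r)\<^sup>2 - 2 * (r \<bullet> z) + (norm z)\<^sup>2"
    unfolding power2_norm_eq_inner by (simp add: inner_diff_left inner_diff_right inner_commute)
  have "0 \<le> (norm (e *\<^sub>R r - \<nu> *\<^sub>R z))\<^sup>2" by simp
  also have "\<dots> = e\<^sup>2 * (norm r)\<^sup>2 - 2 * e * \<nu> * (r \<bullet> z) + \<nu>\<^sup>2 * (norm z)\<^sup>2"
    unfolding power2_norm_eq_inner
    by (simp add: inner_diff_left inner_diff_right inner_commute power2_eq_square algebra_simps)
  also have "\<dots> = e * (- \<kappa> * (norm r)\<^sup>2 + \<kappa> * \<nu> / (\<nu> - \<kappa>) * (norm z)\<^sup>2 + \<nu> * (norm (r - z))\<^sup>2)"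
    unfolding diff e_def[symmetric] \<kappa> using \<open>e > 0\<close> by (simp add: field_simps power2_eq_square)
  finally show ?thesis using \<open>e > 0\<close> by (simp add: zero_le_mult_iff)
qed

text \<open>
  With \<open>\<nu>1\<close>, \<open>\<rho>1\<close> and \<open>\<nu>2\<close>, \<open>\<rho>2\<close> the indices of the two blocks, \<open>\<kappa>\<close> and \<open>\<eta>\<close> are admissible
  indices of the loop. The part \<open>z\<close> of the first input is paid for by \<open>\<rho>2\<close>, and the part \<open>y\<close> of the
  second one by \<open>\<rho>1\<close>.
\<close>

lemma feedback_supply_le:
  fixes r1 r2 y z :: "'a::real_inner"
  assumes "\<kappa> < min \<nu>1 \<nu>2"
    and "\<eta> \<le> min (\<rho>1 - \<kappa> * \<nu>2 / (\<nu>2 - \<kappa>)) (\<rho>2 - \<kappa> * \<nu>1 / (\<nu>1 - \<kappa>))"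
  shows "((r1 - z) \<bullet> y - \<nu>1 * (norm (r1 - z))\<^sup>2 - \<rho>1 * (norm y)\<^sup>2)
       + ((r2 + y) \<bullet> z - \<nu>2 * (norm (r2 + y))\<^sup>2 - \<rho>2 * (norm z)\<^sup>2)
    \<le> (r1, r2) \<bullet> (y, z) - \<kappa> * (norm (r1, r2))\<^sup>2 - \<eta> * (norm (y, z))\<^sup>2"
proof -
  have "\<eta> * (norm y)\<^sup>2 \<le> (\<rho>1 - \<kappa> * \<nu>2 / (\<nu>2 - \<kappa>)) * (norm y)\<^sup>2"
    "\<eta> * (norm z)\<^sup>2 \<le> (\<rho>2 - \<kappa> * \<nu>1 / (\<nu>1 - \<kappa>)) * (norm z)\<^sup>2"
    using assms(2) by (auto intro!: mult_right_mono)
  moreover have "- \<nu>1 * (norm (r1 - z))\<^sup>2 \<le> - \<kappa> * (norm r1)\<^sup>2 + \<kappa> * \<nu>1 / (\<nu>1 - \<kappa>) * (norm z)\<^sup>2"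
    using assms(1) by (intro input_index_transfer) simp
  moreover have "- \<nu>2 * (norm (r2 + y))\<^sup>2 \<le> - \<kappa> * (norm r2)\<^sup>2 + \<kappa> * \<nu>2 / (\<nu>2 - \<kappa>) * (norm y)\<^sup>2"
    using assms(1) input_index_transfer[of \<kappa> \<nu>2 r2 "- y"] by simp
  moreover have "(r1 - z) \<bullet> y + (r2 + y) \<bullet> z = (r1, r2) \<bullet> (y, z)"
    by (simp add: inner_diff_left inner_add_left inner_commute[of y z])
  moreover have "(norm (r1, r2))\<^sup>2 = (norm r1)\<^sup>2 + (norm r2)\<^sup>2" "(norm (y, z))\<^sup>2 = (norm y)\<^sup>2 + (norm z)\<^sup>2"
    by (simp_all add: norm_Pair)
  ultimately show ?thesis by (simp add: algebra_simps)
qed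

theorem theorem3:
  fixes P :: "('n1::finite, 'm::finite) ctrl_sys"
    and \<Sigma> :: "('n2::finite, 'm) ctrl_sys"
    and h11 h21 h12 h22
    and \<beta>1 V1 \<delta>1 :: "real ^ 'n1 \<Rightarrow> real"
    and \<beta>2 V2 \<delta>2 :: "real ^ 'n2 \<Rightarrow> real"
    and V \<delta> :: "(real ^ 'n1) \<times> (real ^ 'n2) \<Rightarrow> real"
    and \<tau> \<mu>1 \<mu>2 \<gamma>1 \<gamma>2 \<nu>1 \<rho>1 \<nu>2 \<rho>2 :: real
    and l11 l21 l22 l23 l24 l25 :: real
    and \<nu>1' \<rho>1' \<nu>2' \<rho>2' \<nu>2t \<rho>2t \<delta>2t \<nu>h \<rho>h :: real
  assumes "\<tau> > 0" "\<mu>1 > 0" "\<mu>2 > 0"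
    and "control_system P" "control_system \<Sigma>"
    and "output_splits P h11 h12" "output_rate_bounded P h11 \<gamma>1 \<beta>1"
    and "output_splits \<Sigma> h21 h22" "output_rate_bounded \<Sigma> h21 \<gamma>2 \<beta>2"
    and "storage_function V1" "IF_OFP P V1 \<nu>1 \<rho>1"
    and "storage_function V2" "IF_OFP \<Sigma> V2 \<nu>2 \<rho>2"
    and "l11 > 0" "l21 > 0" "l22 > 0" "l23 > 0" "l24 > 0" "l25 > 0"
    and "\<nu>1' = \<nu>1 - \<tau> * \<gamma>1 - \<tau>\<^sup>2 * \<gamma>1\<^sup>2 * (1 + l11) * \<bar>\<rho>1\<bar>"
    and "\<rho>1' = \<rho>1 - \<bar>\<rho>1\<bar> / l11"
    and "\<And>x1. \<delta>1 x1 = (\<bar>\<rho>1\<bar> * \<tau> * (1 + l11) + 1 / \<gamma>1) * \<beta>1 x1"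
    and "\<nu>2' = \<nu>2 - \<tau> * \<gamma>2 - \<tau>\<^sup>2 * \<gamma>2\<^sup>2 * (1 + l21) * \<bar>\<rho>2\<bar>"
    and "\<rho>2' = \<rho>2 - \<bar>\<rho>2\<bar> / l21"
    and "\<And>x2. \<delta>2 x2 = (\<bar>\<rho>2\<bar> * \<tau> * (1 + l21) + 1 / \<gamma>2) * \<beta>2 x2"
    and "\<nu>2t = \<nu>2' - \<bar>\<nu>2'\<bar> / l23 - 1 / (4 * l24)"
    and "\<rho>2t = \<rho>2' - \<bar>\<rho>2'\<bar> / l22 - 1 / (4 * l25)"
    and "\<delta>2t = (\<bar>\<rho>2'\<bar> * (1 + l22) + l24) * real CARD('m) * \<mu>2\<^sup>2
             + (\<bar>\<nu>2'\<bar> * (1 + l23) + l25) * real CARD('m) * \<mu>1\<^sup>2"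
    and "\<And>x1 x2. V (x1, x2) = 1 / \<tau> * V1 x1 + 1 / \<tau> * V2 x2"
    and "\<And>x1 x2. \<delta> (x1, x2) = \<delta>1 x1 + \<delta>2 x2"
    and "\<nu>h < min \<nu>1' \<nu>2t"
    and "\<rho>h \<le> min (\<rho>1' - \<nu>h * \<nu>2t / (\<nu>2t - \<nu>h)) (\<rho>2t - \<nu>h * \<nu>1' / (\<nu>1' - \<nu>h))"
  shows "\<forall>r x y. feedback \<tau> \<mu>1 \<mu>2 P \<Sigma> r x y \<longrightarrow> (\<forall>k0 k1. k0 < k1 \<longrightarrow>
           V (x k1) - V (x k0)
             \<le> \<delta> (x k0) + (\<Sum>k = k0..<k1. r k \<bullet> y k - \<nu>h * (norm (r k))\<^sup>2
                                      - \<rho>h * (norm (y k))\<^sup>2 + \<delta>2t))"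
proof (intro allI impI)
  fix r x y and k0 k1 :: nat
  assume fb: "feedback \<tau> \<mu>1 \<mu>2 P \<Sigma> r x y" and k: "k0 < k1"
  define r1 r2 x1 x2 y1 z where "r1 k = fst (r k)" and "r2 k = snd (r k)"
    and "x1 k = fst (x k)" and "x2 k = snd (x k)" and "y1 k = fst (y k)" and "z k = snd (y k)" for k
  note components = r1_def r2_def x1_def x2_def y1_def z_def
  define v where "v k = r2 k + y1 k" for k
  have sP: "sampled \<tau> P (\<lambda>k. r1 k - z k) x1 y1"
    using fb by (simp add: feedback_def components[abs_def])
  obtain y2 where sS: "sampled \<tau> \<Sigma> (\<lambda>k. quantize \<mu>1 (v k)) x2 y2" and z: "\<And>k. z k = quantize \<mu>2 (y2 k)"
    using fb by (auto simp: feedback_def quantized_sampled_def components[abs_def] v_def)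
  \<comment> \<open>The plant's supply rate in its own input and output, and that of the sampled controller in the
    signals that it sees, inside the quantizers.\<close>
  define sP' where "sP' k = (r1 k - z k) \<bullet> y1 k - \<nu>1' * (norm (r1 k - z k))\<^sup>2 - \<rho>1' * (norm (y1 k))\<^sup>2" for k
  define sS' where "sS' k = quantize \<mu>1 (v k) \<bullet> y2 k - \<nu>2' * (norm (quantize \<mu>1 (v k)))\<^sup>2
      - \<rho>2' * (norm (y2 k))\<^sup>2" for k
  have P_dissip: "1 / \<tau> * V1 (x1 k1) - 1 / \<tau> * V1 (x1 k0) \<le> \<delta>1 (x1 k0) + (\<Sum>k = k0..<k1. sP' k)"
    unfolding sP'_def assms(20-22) using assms(1,4,6,7,11,14) sP k
    by (intro sampled_dissipation) auto
  have S_dissip: "1 / \<tau> * V2 (x2 k1) - 1 / \<tau> * V2 (x2 k0) \<le> \<delta>2 (x2 k0) + (\<Sum>k = k0..<k1. sS' k)"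
    unfolding sS'_def assms(23-25) using assms(1,5,8,9,13,15) sS k
    by (intro sampled_dissipation) auto
  have V_eq: "V (x k) = 1 / \<tau> * V1 (x1 k) + 1 / \<tau> * V2 (x2 k)" for k
    using assms(29)[of "x1 k" "x2 k"] by (simp add: components)
  have \<delta>_eq: "\<delta> (x k) = \<delta>1 (x1 k) + \<delta>2 (x2 k)" for k
    using assms(30)[of "x1 k" "x2 k"] by (simp add: components)
  have "sP' k + sS' k \<le> r k \<bullet> y k - \<nu>h * (norm (r k))\<^sup>2 - \<rho>h * (norm (y k))\<^sup>2 + \<delta>2t" for k
  proof -
    have "sS' k \<le> v k \<bullet> z k - \<nu>2t * (norm (v k))\<^sup>2 - \<rho>2t * (norm (z k))\<^sup>2 + \<delta>2t"
      unfolding sS'_def z assms(26-28) using assms(2,3,16-19) by (intro quantized_supply_le)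
    then show ?thesis
      using feedback_supply_le[OF assms(31,32), of "r1 k" "z k" "y1 k" "r2 k"]
      unfolding sP'_def v_def by (simp add: components)
  qed
  then have supply_le: "(\<Sum>k = k0..<k1. sP' k) + (\<Sum>k = k0..<k1. sS' k)
      \<le> (\<Sum>k = k0..<k1. r k \<bullet> y k - \<nu>h * (norm (r k))\<^sup>2 - \<rho>h * (norm (y k))\<^sup>2 + \<delta>2t)"
    unfolding sum.distrib[symmetric] by (intro sum_mono)
  show "V (x k1) - V (x k0)
      \<le> \<delta> (x k0) + (\<Sum>k = k0..<k1. r k \<bullet> y k - \<nu>h * (norm (r k))\<^sup>2
                                      - \<rho>h * (norm (y k))\<^sup>2 + \<delta>2t)"
    using P_dissip S_dissip supply_le V_eq[of k0] V_eq[of k1] \<delta>_eq[of k0] by linarith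
qed

end
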